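(* $\mathcal{C}_2 = \mathcal{U}$, where $\mathcal{C}_2=\{q\in(1,2) : \text{there exists } x\in I_q \text{ such that } |\Omega_{E_q}(x)|=2\}$ and $\mathcal{U}=\{q\in(1,2) : 1 \text{ has a unique base } q \text{ expansion}\}$.
   Context: For $q\in(1,2)$ let $I_q=[0,\frac1{q-1}]$. A base $q$ expansion of $x\in I_q$ is a sequence $(i_j)_{j=1}^\infty\in\{0,1\}^{\mathbb{N}}$ with $x=\sum_{j=1}^\infty i_jq^{-j}$. Let $E_q=\{f_0,f_1,f_2\}$ be the partial maps of $I_q$ given by $f_0:[0,\frac1{q(q-1)})\to[0,\frac1{q-1})$, $f_0(x)=qx$; $f_1:(\frac1q,\frac1{q(q-1)}]\to[0,\frac1{q-1})$, $f_1(x)=\frac1{q-1}-\frac1{2-q}(qx-1)$; $f_2:[\frac1q,\frac1{q-1}]\to[0,\frac1{q-1}]$, $f_2(x)=qx-1$. For $x\in I_q$, the orbit space $\Omega_{E_q}(x)$ is the set of sequences $(f_{i_j})_{j=1}^\infty\in\{f_0,f_1,f_2\}^{\mathbb{N}}$ such that for every $k\ge0$ the composition $f_{i_k}\circ\cdots\circ f_{i_1}$ is defined at $x$ (i.e. $f_{i_{l-1}}\circ\cdots\circ f_{i_1}(x)$ lies in the domain of $f_{i_l}$ for all $1\le l\le k$) and its value lies in $I_q$. Sequences are distinguished by their index sequences. $|\cdot|$ denotes cardinality. *)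

theory Defs
  imports Complex_Main
begin

definition I :: "real \<Rightarrow> real set" where
  "I q = {0..1 / (q - 1)}"

(* Throughout, a sequence (i_j), j >= 1, is a function on nat whose value at j is i_(j+1). *)

definition is_expansion :: "real \<Rightarrow> real \<Rightarrow> (nat \<Rightarrow> nat) \<Rightarrow> bool" where
  "is_expansion q x i \<longleftrightarrow> range i \<subseteq> {0, 1} \<and> (\<lambda>j. real (i j) / q ^ Suc j) sums x"

definition f0 :: "real \<Rightarrow> real \<rightharpoonup> real" where
  "f0 q = (\<lambda>x. Some (q * x)) |` {0..<1 / (q * (q - 1))}"

definition f1 :: "real \<Rightarrow> real \<rightharpoonup> real" where
  "f1 q = (\<lambda>x. Some (1 / (q - 1) - 1 / (2 - q) * (q * x - 1))) |` {1 / q<..1 / (q * (q - 1))}"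

(* The right endpoint 1/(q - 1) belongs to the domain of f2 and is a fixed point, so the range of
   f2 is the closed interval I q, not the half-open one. *)
definition f2 :: "real \<Rightarrow> real \<rightharpoonup> real" where
  "f2 q = (\<lambda>x. Some (q * x - 1)) |` {1 / q..1 / (q - 1)}"

definition E :: "real \<Rightarrow> nat \<Rightarrow> (real \<rightharpoonup> real)" where
  "E q = (\<lambda>_. Map.empty)(0 := f0 q, 1 := f1 q, 2 := f2 q)"

primrec E_comp :: "real \<Rightarrow> (nat \<Rightarrow> nat) \<Rightarrow> nat \<Rightarrow> (real \<rightharpoonup> real)" where
  "E_comp q i 0 = Some"
| "E_comp q i (Suc k) = E q (i k) \<circ>\<^sub>m E_comp q i k"

(* A sequence of maps is represented by its index sequence. *)
definition Omega :: "real \<Rightarrow> real \<Rightarrow> (nat \<Rightarrow> nat) set" where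
  "Omega q x = {i. range i \<subseteq> {0, 1, 2} \<and> (\<forall>k. \<exists>y\<in>I q. E_comp q i k x = Some y)}"

(* card is 0 on infinite sets, so the equation below also says that Omega q x is finite. *)
definition C2 :: "real set" where
  "C2 = {q \<in> {1<..<2}. \<exists>x\<in>I q. card (Omega q x) = 2}"

definition U :: "real set" where
  "U = {q \<in> {1<..<2}. \<exists>!i. is_expansion q 1 i}"

end

theory Submission
  imports Defs
begin

text \<open>Both base $q$ expansions and the sequences in $\Omega_{E_q}(x)$ are infinite paths through a
  system of partial maps of $I_q$: expansions come from $x \mapsto qx$ and $x \mapsto qx-1$, each
  allowed whenever the result stays in $I_q$. In either system every point admits a move, so every
  point starts a path, and it starts exactly one path iff its orbit only meets points with a single
  move (\<open>ex1_path_iff_forced\<close>). The two systems have the same points with several moves, namely the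
  closed switch region $[\frac1q, \frac1{q(q-1)}]$, and move identically off that region. Hence a
  point has a unique expansion iff it has a unique $E_q$-orbit (\<open>forced_E_iff\<close>).

  A point has exactly two $E_q$-orbits iff its orbit is forced up to some point with exactly two
  moves, both of whose images have a unique orbit. Inside the switch region all three maps apply;
  only at its two endpoints are there exactly two moves. From $\frac1q$ they lead to $1$ and $0$,
  and from $\frac1{q(q-1)}$ to $0$ and $\frac1{q-1}-1$. The point $0$ is fixed and always has a
  unique orbit. The reflection $x \mapsto \frac1{q-1}-x$ exchanges $1$ and $\frac1{q-1}-1$ and
  respects expansions, so at either endpoint the condition is that $1$ has a unique expansion.\<close>

section \<open>Paths in systems of partial maps\<close>

coinductive path :: "(nat \<Rightarrow> 'a \<rightharpoonup> 'a) \<Rightarrow> 'a \<Rightarrow> (nat \<Rightarrow> nat) \<Rightarrow> bool" for G where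
  path_step: "G (i 0) x = Some y \<Longrightarrow> path G y (\<lambda>n. i (Suc n)) \<Longrightarrow> path G x i"

definition only_move :: "(nat \<Rightarrow> 'a \<rightharpoonup> 'a) \<Rightarrow> 'a \<Rightarrow> nat \<Rightarrow> 'a \<Rightarrow> bool" where
  "only_move G x a y \<longleftrightarrow> G a x = Some y \<and> (\<forall>b. b \<noteq> a \<longrightarrow> G b x = None)"

coinductive forced :: "(nat \<Rightarrow> 'a \<rightharpoonup> 'a) \<Rightarrow> 'a \<Rightarrow> bool" for G where
  "only_move G x a y \<Longrightarrow> forced G y \<Longrightarrow> forced G x"

definition live_on :: "(nat \<Rightarrow> 'a \<rightharpoonup> 'a) \<Rightarrow> 'a set \<Rightarrow> bool" where
  "live_on G X \<longleftrightarrow> (\<forall>x\<in>X. (\<exists>a. G a x \<noteq> None) \<and> (\<forall>a y. G a x = Some y \<longrightarrow> y \<in> X))"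

lemma path_Cons_iff: "path G x (case_nat a i) \<longleftrightarrow> (\<exists>y. G a x = Some y \<and> path G y i)"
  by (subst path.simps) auto

lemma pathE:
  assumes "path G x i"
  obtains y where "G (i 0) x = Some y" "path G y (\<lambda>n. i (Suc n))"
  using assms by (auto elim: path.cases)

lemma case_nat_tail: "case_nat (i 0) (\<lambda>n. i (Suc n)) = i"
  by (auto simp: fun_eq_iff split: nat.split)

lemma case_nat_inject: "case_nat a i = case_nat b j \<longleftrightarrow> a = b \<and> i = j"
proof
  assume *: "case_nat a i = case_nat b j"
  have "i n = j n" for n
    using fun_cong[OF *, of "Suc n"] by simp
  moreover have "a = b"
    using fun_cong[OF *, of 0] by simp
  ultimately show "a = b \<and> i = j"
    by auto
qed simp

lemma live_onD:
  assumes "live_on G X" "x \<in> X" "G a x = Some y"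
  shows "y \<in> X"
  using assms by (auto simp: live_on_def)

text \<open>The path follows at each point an arbitrarily chosen available move.\<close>

lemma path_exists:
  assumes "live_on G X" "x \<in> X"
  shows "\<exists>i. path G x i"
proof -
  define c where "c x = (SOME a. G a x \<noteq> None)" for x
  have c: "G (c y) y \<noteq> None" if "y \<in> X" for y
    unfolding c_def using assms(1) that someI_ex[of "\<lambda>a. G a y \<noteq> None"]
    by (auto simp: live_on_def)
  define t where "t y = the (G (c y) y)" for y
  have t: "G (c y) y = Some (t y)" "t y \<in> X" if "y \<in> X" for y
    using c[OF that] live_onD[OF assms(1) that, of "c y"] by (auto simp: t_def)
  have "path G x (\<lambda>n. c ((t ^^ n) x))"
    using assms(2)
  proof (coinduction arbitrary: x)
    case (path z)
    have "(\<lambda>n. c ((t ^^ Suc n) z)) = (\<lambda>n. c ((t ^^ n) (t z)))"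
      by (simp only: funpow_Suc_right comp_apply)
    then show ?case
      using t[OF path] by (intro exI[of _ "\<lambda>n. c ((t ^^ n) z)"] exI[of _ z] exI[of _ "t z"]) auto
  qed
  then show ?thesis by blast
qed

lemma only_move_path:
  assumes "only_move G x a y" "path G x i"
  shows "i 0 = a" "path G y (\<lambda>n. i (Suc n))"
proof -
  obtain u where u: "G (i 0) x = Some u" "path G u (\<lambda>n. i (Suc n))"
    using assms(2) by (rule pathE)
  then show "i 0 = a"
    using assms(1) by (cases "i 0 = a") (simp_all add: only_move_def)
  then show "path G y (\<lambda>n. i (Suc n))"
    using assms(1) u by (simp add: only_move_def)
qed

lemma forced_path_unique:
  assumes "forced G x" "path G x i" "path G x j"
  shows "i = j"
proof
  fix n
  show "i n = j n"
    using assms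
  proof (induction n arbitrary: x i j)
    case 0
    then show ?case
      by (metis forced.cases only_move_path(1))
  next
    case (Suc n)
    then show ?case
      by (metis forced.cases only_move_path(2))
  qed
qed

text \<open>A second move at some point of the orbit would lead to a point that starts a path of its own,
  hence would create a second path.\<close>

lemma ex1_path_iff_forced:
  assumes live: "live_on G X" and "x \<in> X"
  shows "(\<exists>!i. path G x i) \<longleftrightarrow> forced G x"
proof
  assume "forced G x"
  then show "\<exists>!i. path G x i"
    using path_exists[OF assms] forced_path_unique[of G x] by (intro ex_ex1I) simp_all
next
  assume "\<exists>!i. path G x i"
  then show "forced G x"
    using \<open>x \<in> X\<close>
  proof (coinduction arbitrary: x)
    case (forced z)
    then obtain i where i: "path G z i" "\<And>j. path G z j \<Longrightarrow> j = i"
      by blast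
    obtain y where y: "G (i 0) z = Some y" "path G y (\<lambda>n. i (Suc n))"
      using i(1) by (rule pathE)
    have "G b z = None" if "b \<noteq> i 0" for b
    proof (rule ccontr)
      assume "G b z \<noteq> None"
      then obtain w where w: "G b z = Some w"
        by blast
      obtain j where "path G w j"
        using path_exists[OF live live_onD[OF live \<open>z \<in> X\<close> w]] by blast
      then have "case_nat b j = i"
        using w by (intro i(2)) (auto simp: path_Cons_iff)
      then have "b = i 0"
        by (metis case_nat_tail case_nat_inject)
      with that show False by simp
    qed
    then have "only_move G z (i 0) y"
      using y by (auto simp: only_move_def)
    moreover have "j = (\<lambda>n. i (Suc n))" if "path G y j" for j
    proof -
      have "case_nat (i 0) j = i"
        using y that by (intro i(2)) (auto simp: path_Cons_iff)
      then show ?thesis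
        by (metis case_nat_tail case_nat_inject)
    qed
    ultimately show ?case
      using y live_onD[OF live \<open>z \<in> X\<close> y(1)] by blast
  qed
qed

text \<open>Forcedness sees only the points visited, not the labels of the maps, so it carries over along
  any map that takes single moves of one system to single moves of another.\<close>

lemma forced_transfer:
  assumes "forced G x" "x \<in> X"
    and "\<And>x a y. x \<in> X \<Longrightarrow> only_move G x a y \<Longrightarrow> y \<in> X \<and> (\<exists>b. only_move H (h x) b (h y))"
  shows "forced H (h x)"
  using assms(1,2)
proof (coinduction arbitrary: x)
  case (forced z)
  then obtain a y where "only_move G z a y" "forced G y"
    by (auto elim: forced.cases)
  then show ?case
    using assms(3) forced by blast
qed

definition splits :: "(nat \<Rightarrow> 'a \<rightharpoonup> 'a) \<Rightarrow> 'a \<Rightarrow> nat \<Rightarrow> 'a \<Rightarrow> nat \<Rightarrow> 'a \<Rightarrow> bool" where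
  "splits G x a u b v \<longleftrightarrow> a \<noteq> b \<and> G a x = Some u \<and> G b x = Some v
     \<and> (\<forall>c. c \<noteq> a \<longrightarrow> c \<noteq> b \<longrightarrow> G c x = None)"

lemma card_paths_split:
  assumes "splits G x a u b v" "\<exists>!i. path G u i" "\<exists>!j. path G v j"
  shows "card {k. path G x k} = 2"
proof -
  obtain i j where i: "{i. path G u i} = {i}" and j: "{j. path G v j} = {j}"
    using assms(2,3) by blast
  have "path G x k \<longleftrightarrow> k = case_nat a i \<or> k = case_nat b j" (is "_ \<longleftrightarrow> ?R") for k
  proof
    assume "path G x k"
    then obtain y where y: "G (k 0) x = Some y" "path G y (\<lambda>n. k (Suc n))"
      by (rule pathE)
    then have "k 0 = a \<and> y = u \<or> k 0 = b \<and> y = v"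
      using assms(1) by (cases "k 0 = a"; cases "k 0 = b") (auto simp: splits_def)
    then have "k 0 = a \<and> (\<lambda>n. k (Suc n)) = i \<or> k 0 = b \<and> (\<lambda>n. k (Suc n)) = j"
      using y i j by blast
    then show ?R
      by (metis case_nat_tail)
  next
    assume ?R
    then show "path G x k"
      using assms(1) i j by (auto simp: path_Cons_iff splits_def)
  qed
  then have "{k. path G x k} = {case_nat a i, case_nat b j}"
    by auto
  then show ?thesis
    using assms(1) by (simp add: splits_def case_nat_inject)
qed

text \<open>The branching point is where the two paths first differ. A third move there, or a second path
  from either of the two images, would yield a third path from the starting point.\<close>

lemma card_paths_2_imp_split:
  assumes live: "live_on G X" and "x \<in> X" "card {i. path G x i} = 2"
  shows "\<exists>y a u b v. y \<in> X \<and> splits G y a u b v \<and> (\<exists>!i. path G u i) \<and> (\<exists>!j. path G v j)"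
proof -
  obtain i j where ij: "{i. path G x i} = {i, j}" "i \<noteq> j"
    using assms(3) by (auto simp: card_2_iff)
  then obtain n where "i n \<noteq> j n"
    by auto
  with ij(1) \<open>x \<in> X\<close> show ?thesis
  proof (induction n arbitrary: x i j rule: less_induct)
    case (less n)
    have only: "k = i \<or> k = j" if "path G x k" for k
      using less.prems(1) that by blast
    obtain u where u: "G (i 0) x = Some u" "path G u (\<lambda>n. i (Suc n))"
      using less.prems(1) by (metis insertI1 mem_Collect_eq pathE)
    obtain v where v: "G (j 0) x = Some v" "path G v (\<lambda>n. j (Suc n))"
      using less.prems(1) by (metis insertI1 insert_commute mem_Collect_eq pathE)
    have lift: "a = i 0 \<and> k = (\<lambda>n. i (Suc n)) \<or> a = j 0 \<and> k = (\<lambda>n. j (Suc n))"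
      if "G a x = Some y" "path G y k" for a y k
    proof -
      have "case_nat a k = i \<or> case_nat a k = j"
        using that by (intro only) (auto simp: path_Cons_iff)
      then show ?thesis
        by (metis case_nat_tail case_nat_inject)
    qed
    show ?case
    proof (cases "i 0 = j 0")
      case True
      have "{k. path G u k} = {\<lambda>n. i (Suc n), \<lambda>n. j (Suc n)}"
        using lift[OF u(1)] u v True by auto
      moreover obtain m where "n = Suc m"
        using less.prems True by (cases n) auto
      ultimately show ?thesis
        using less.IH[of m u "\<lambda>n. i (Suc n)" "\<lambda>n. j (Suc n)"] less.prems
          live_onD[OF live \<open>x \<in> X\<close> u(1)] by blast
    next
      case False
      have "G c x = None" if "c \<noteq> i 0" "c \<noteq> j 0" for c
      proof (rule ccontr)
        assume "G c x \<noteq> None"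
        then obtain z where z: "G c x = Some z"
          by blast
        then obtain k where "path G z k"
          using path_exists[OF live live_onD[OF live \<open>x \<in> X\<close> z]] by blast
        then show False
          using lift z that by blast
      qed
      then have "splits G x (i 0) u (j 0) v"
        using u v False by (auto simp: splits_def)
      moreover have "\<exists>!k. path G u k"
        using u lift[OF u(1)] False by blast
      moreover have "\<exists>!k. path G v k"
        using v lift[OF v(1)] False by metis
      ultimately show ?thesis
        using less.prems by blast
    qed
  qed
qed

section \<open>The orbit space as a set of paths\<close>

lemma mem_I_iff:
  assumes "1 < q"
  shows "x \<in> I q \<longleftrightarrow> 0 \<le> q * x \<and> q * x \<le> 1 / (q - 1) + 1"
proof -
  have "1 / (q - 1) + 1 = q * (1 / (q - 1))"
    using assms by (simp add: field_simps)
  then show ?thesis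
    using assms mult_le_cancel_left_pos[of q x "1 / (q - 1)"] by (simp add: I_def zero_le_mult_iff)
qed

text \<open>All three domains become intervals for $qx$ with endpoints among $0$, $1$, $s = \frac1{q-1}$ and
  $qs = s+1$, which leaves only linear conditions.\<close>

lemma E_eq_Some_iff:
  assumes "1 < q"
  shows "E q a x = Some y \<longleftrightarrow>
      a = 0 \<and> 0 \<le> q * x \<and> q * x < 1 / (q - 1) \<and> y = q * x
    \<or> a = 1 \<and> 1 < q * x \<and> q * x \<le> 1 / (q - 1) \<and> y = 1 / (q - 1) - (q * x - 1) / (2 - q)
    \<or> a = 2 \<and> 1 \<le> q * x \<and> q * x \<le> 1 / (q - 1) + 1 \<and> y = q * x - 1"
proof -
  define s where "s = 1 / (q - 1)"
  have s: "1 / (q * (q - 1)) = s / q" "s + 1 = q * s"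
    using assms by (auto simp: s_def field_simps)
  have dom: "0 \<le> x \<longleftrightarrow> 0 \<le> q * x" "x < s / q \<longleftrightarrow> q * x < s" "x \<le> s / q \<longleftrightarrow> q * x \<le> s"
    "1 / q < x \<longleftrightarrow> 1 < q * x" "1 / q \<le> x \<longleftrightarrow> 1 \<le> q * x" "x \<le> s \<longleftrightarrow> q * x \<le> s + 1"
    using assms unfolding s(2) by (auto simp: field_simps zero_le_mult_iff)
  show ?thesis
    unfolding E_def f0_def f1_def f2_def s(1) s_def[symmetric]
    by (auto simp: restrict_map_def dom)
qed

text \<open>The formula for $f_1$, in terms of $t = qx$ and $s = \frac1{q-1}$, decreases from $s$ at $t = 1$
  to $0$ at $t = s$, because $s - 1 = (2-q)s$.\<close>

lemma flip_range:
  assumes "1 < q" "q < 2" "1 < t" "t \<le> 1 / (q - 1)"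
  shows "1 / (q - 1) - (t - 1) / (2 - q) \<in> I q"
proof -
  have "(t - 1) / (2 - q) \<le> (1 / (q - 1) - 1) / (2 - q)"
    using assms by (intro divide_right_mono) auto
  also have "\<dots> = 1 / (q - 1)"
    using assms by (simp add: divide_simps)
  finally show ?thesis
    using assms by (auto simp: I_def)
qed

lemma one_less_bound:
  fixes q :: real
  assumes "1 < q" "q < 2"
  shows "1 < 1 / (q - 1)"
  using assms by (simp add: field_simps)

lemma live_on_E:
  assumes q: "1 < q" "q < 2"
  shows "live_on (E q) (I q)"
  unfolding live_on_def
proof (intro ballI conjI allI impI)
  fix x
  assume "x \<in> I q"
  then have t: "0 \<le> q * x" "q * x \<le> 1 / (q - 1) + 1"
    using mem_I_iff[OF q(1)] by auto
  show "\<exists>a. E q a x \<noteq> None"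
  proof (cases "q * x < 1 / (q - 1)")
    case True
    then have "E q 0 x = Some (q * x)"
      using t by (subst E_eq_Some_iff[OF q(1)]) auto
    then show ?thesis by force
  next
    case False
    then have "E q 2 x = Some (q * x - 1)"
      using t one_less_bound[OF q] by (subst E_eq_Some_iff[OF q(1)]) auto
    then show ?thesis by force
  qed
  fix a y
  assume "E q a x = Some y"
  then show "y \<in> I q"
    unfolding E_eq_Some_iff[OF q(1)] using flip_range[OF q] by (auto simp: I_def)
qed

lemma Omega_eq_paths:
  assumes q: "1 < q" "q < 2" and "x \<in> I q"
  shows "Omega q x = {i. path (E q) x i}"
proof (intro equalityI subsetI)
  fix i
  assume "i \<in> Omega q x"
  then have i: "\<exists>y\<in>I q. E_comp q i k x = Some y" for k
    by (auto simp: Omega_def)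
  have *: "path (E q) y j" if "\<exists>k. j = (\<lambda>n. i (n + k)) \<and> E_comp q i k x = Some y" for y j
    using that
  proof (coinduction arbitrary: y j)
    case (path z l)
    then obtain k where k: "l = (\<lambda>n. i (n + k))" "E_comp q i k x = Some z"
      by blast
    obtain w where w: "E_comp q i (Suc k) x = Some w"
      using i by blast
    then have "E q (l 0) z = Some w"
      using k by simp
    moreover have "(\<lambda>n. l (Suc n)) = (\<lambda>n. i (n + Suc k))"
      using k by simp
    ultimately show ?case
      using w by blast
  qed
  have "path (E q) x i"
    by (rule *) (rule exI[of _ 0], simp)
  then show "i \<in> {i. path (E q) x i}"
    by simp
next
  fix i
  assume "i \<in> {i. path (E q) x i}"
  then have *: "\<exists>y\<in>I q. E_comp q i k x = Some y \<and> path (E q) y (\<lambda>n. i (n + k))" for k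
  proof (induction k)
    case 0
    then show ?case using \<open>x \<in> I q\<close> by auto
  next
    case (Suc k)
    then obtain y where y: "y \<in> I q" "E_comp q i k x = Some y" "path (E q) y (\<lambda>n. i (n + k))"
      by blast
    from y(3) obtain z where "E q (i k) y = Some z" "path (E q) z (\<lambda>n. i (n + Suc k))"
      by (auto elim: pathE)
    with y show ?case
      using live_onD[OF live_on_E[OF q]] by auto
  qed
  have "i k \<in> {0, 1, 2}" for k
  proof -
    obtain y where "path (E q) y (\<lambda>n. i (n + k))"
      using * by blast
    then obtain z where "E q (i k) y = Some z"
      by (auto elim: pathE)
    then show ?thesis
      unfolding E_eq_Some_iff[OF q(1)] by auto
  qed
  then show "i \<in> Omega q x"
    using * by (simp add: Omega_def image_subset_iff) blast
qed

section \<open>Expansions as paths\<close>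

definition digit_map :: "real \<Rightarrow> nat \<Rightarrow> real \<rightharpoonup> real" where
  "digit_map q a x = (if a \<in> {0, 1} \<and> q * x - real a \<in> I q then Some (q * x - real a) else None)"

lemma digit_map_eq_Some_iff:
  "digit_map q a x = Some y \<longleftrightarrow>
      a = 0 \<and> 0 \<le> q * x \<and> q * x \<le> 1 / (q - 1) \<and> y = q * x
    \<or> a = 1 \<and> 1 \<le> q * x \<and> q * x \<le> 1 / (q - 1) + 1 \<and> y = q * x - 1"
  by (auto simp: digit_map_def I_def)

lemma live_on_digit_map:
  assumes q: "1 < q" "q < 2"
  shows "live_on (digit_map q) (I q)"
  unfolding live_on_def
proof (intro ballI conjI allI impI)
  fix x
  assume "x \<in> I q"
  then have t: "0 \<le> q * x" "q * x \<le> 1 / (q - 1) + 1"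
    using mem_I_iff[OF q(1)] by auto
  show "\<exists>a. digit_map q a x \<noteq> None"
  proof (cases "q * x \<le> 1 / (q - 1)")
    case True
    then have "digit_map q 0 x \<noteq> None"
      using t by (simp add: digit_map_def I_def)
    then show ?thesis ..
  next
    case False
    then have "digit_map q 1 x \<noteq> None"
      using t one_less_bound[OF q] by (simp add: digit_map_def I_def)
    then show ?thesis ..
  qed
qed (auto simp: digit_map_def split: if_splits)

lemma expansion_mem_I:
  assumes "1 < q" "is_expansion q x i"
  shows "x \<in> I q"
proof -
  have i: "i j \<in> {0, 1}" "(\<lambda>j. real (i j) / q ^ Suc j) sums x" for j
    using assms(2) by (auto simp: is_expansion_def)
  have "(\<lambda>j. (1 / q) ^ j * (1 / q)) sums (1 / (1 - 1 / q) * (1 / q))"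
    using assms(1) by (intro sums_mult2 geometric_sums) auto
  then have geo: "(\<lambda>j. 1 / q ^ Suc j) sums (1 / (q - 1))"
    using assms(1) by (simp add: field_simps)
  have "real (i j) / q ^ Suc j \<le> 1 / q ^ Suc j" for j
    using i(1)[of j] assms(1) by (auto simp: divide_simps)
  then have "x \<le> 1 / (q - 1)"
    using sums_le[OF _ i(2) geo] by blast
  moreover have "0 \<le> x"
    using assms(1) by (intro sums_le[OF _ sums_zero i(2)]) auto
  ultimately show ?thesis
    by (simp add: I_def)
qed

lemma expansion_tail:
  assumes "1 < q" "is_expansion q x i"
  shows "is_expansion q (q * x - real (i 0)) (\<lambda>n. i (Suc n))"
proof -
  have "(\<lambda>j. real (i j) / q ^ Suc j) sums x"
    using assms(2) by (simp add: is_expansion_def)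
  then have "(\<lambda>j. real (i (Suc j)) / q ^ Suc (Suc j)) sums (x - real (i 0) / q)"
    by (subst sums_Suc_iff) simp
  then have "(\<lambda>j. q * (real (i (Suc j)) / q ^ Suc (Suc j))) sums (q * (x - real (i 0) / q))"
    by (rule sums_mult)
  then show ?thesis
    using assms by (auto simp: is_expansion_def algebra_simps image_subset_iff)
qed

text \<open>Along a path the remainder after $n$ digits is the current point divided by $q^n$; it tends
  to $0$ because the points stay in the bounded interval $I_q$.\<close>

lemma expansion_iff_path:
  assumes q: "1 < q" and "x \<in> I q"
  shows "is_expansion q x i \<longleftrightarrow> path (digit_map q) x i"
proof
  assume "is_expansion q x i"
  then show "path (digit_map q) x i"
  proof (coinduction arbitrary: x i)
    case (path z j)
    then have "digit_map q (j 0) z = Some (q * z - real (j 0))"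
      using expansion_mem_I[OF q expansion_tail[OF q path]]
      by (auto simp: digit_map_def is_expansion_def image_subset_iff)
    then show ?case
      using expansion_tail[OF q path] by blast
  qed
next
  assume p: "path (digit_map q) x i"
  have *: "\<exists>y\<in>I q. path (digit_map q) y (\<lambda>m. i (m + n)) \<and>
      x = (\<Sum>j<n. real (i j) / q ^ Suc j) + y / q ^ n" for n
  proof (induction n)
    case 0
    then show ?case using p \<open>x \<in> I q\<close> by auto
  next
    case (Suc n)
    then obtain y where y: "y \<in> I q" "path (digit_map q) y (\<lambda>m. i (m + n))"
      "x = (\<Sum>j<n. real (i j) / q ^ Suc j) + y / q ^ n"
      by blast
    obtain z where z: "digit_map q (i n) y = Some z" "path (digit_map q) z (\<lambda>m. i (m + Suc n))"
      using y(2) by (auto elim: pathE)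
    then have "z \<in> I q" "z = q * y - real (i n)"
      by (auto simp: digit_map_def split: if_splits)
    moreover from this have "y / q ^ n = real (i n) / q ^ Suc n + z / q ^ Suc n"
      using q by (simp add: field_simps)
    ultimately show ?case
      using z y(3) by (intro bexI[of _ z]) simp_all
  qed
  have "i n \<in> {0, 1}" for n
  proof -
    obtain y where "path (digit_map q) y (\<lambda>m. i (m + n))"
      using * by blast
    then obtain z where "digit_map q (i n) y = Some z"
      by (auto elim: pathE)
    then show ?thesis
      by (auto simp: digit_map_def split: if_splits)
  qed
  moreover have "(\<lambda>j. real (i j) / q ^ Suc j) sums x"
    unfolding sums_def
  proof (rule LIM_zero_cancel,
      rule tendsto_0_le[where f = "\<lambda>n. (1 / q) ^ n" and K = "1 / (q - 1)"])
    show "\<forall>\<^sub>F n in sequentially. norm ((\<Sum>j<n. real (i j) / q ^ Suc j) - x)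
        \<le> norm ((1 / q) ^ n) * (1 / (q - 1))"
    proof (intro always_eventually allI)
      fix n
      obtain y where y: "y \<in> I q" "x = (\<Sum>j<n. real (i j) / q ^ Suc j) + y / q ^ n"
        using * by blast
      have "\<bar>(\<Sum>j<n. real (i j) / q ^ Suc j) - x\<bar> = y / q ^ n"
        using y q by (auto simp: I_def)
      also have "\<dots> \<le> 1 / (q - 1) / q ^ n"
        using y q by (intro divide_right_mono) (auto simp: I_def)
      finally show "norm ((\<Sum>j<n. real (i j) / q ^ Suc j) - x)
        \<le> norm ((1 / q) ^ n) * (1 / (q - 1))"
        using q by (simp add: power_one_over mult.commute)
    qed
    show "(\<lambda>n. (1 / q) ^ n) \<longlonglongrightarrow> 0"
      using q by (intro LIMSEQ_power_zero) auto
  qed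
  ultimately show "is_expansion q x i"
    unfolding is_expansion_def image_subset_iff by blast
qed

section \<open>Forced points of the two systems\<close>

lemma only_move_iff:
  "only_move G x a y \<longleftrightarrow> (\<forall>b z. G b x = Some z \<longleftrightarrow> b = a \<and> z = y)"
  unfolding only_move_def by (metis not_Some_eq option.inject)

text \<open>On the closed switch region $1 \le qx \le s$ both digits are available. Hence single moves occur
  exactly outside it, below it with digit $0$ and above it with digit $1$.\<close>

lemma only_move_digit_map_iff:
  assumes q: "1 < q" "q < 2" and "x \<in> I q"
  shows "(\<exists>a. only_move (digit_map q) x a y) \<longleftrightarrow>
    q * x < 1 \<and> y = q * x \<or> 1 / (q - 1) < q * x \<and> y = q * x - 1" (is "?L \<longleftrightarrow> ?R")
proof
  have t: "0 \<le> q * x" "q * x \<le> 1 / (q - 1) + 1"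
    using mem_I_iff[OF q(1)] \<open>x \<in> I q\<close> by auto
  note m = only_move_iff digit_map_eq_Some_iff
  show ?R if L: ?L
  proof -
    obtain a where a: "only_move (digit_map q) x a y"
      using L ..
    have "\<not> (1 \<le> q * x \<and> q * x \<le> 1 / (q - 1))"
    proof
      assume s: "1 \<le> q * x \<and> q * x \<le> 1 / (q - 1)"
      have "a = 0"
        using a[unfolded m, rule_format, of 0 "q * x"] s by auto
      moreover have "a = 1"
        using a[unfolded m, rule_format, of 1 "q * x - 1"] s by auto
      ultimately show False
        by simp
    qed
    then show ?thesis
      using a[unfolded m, rule_format, of a y] by auto
  qed
  show ?L if ?R
  proof (cases "q * x < 1")
    case True
    then have "only_move (digit_map q) x 0 y"
      using that t one_less_bound[OF q] unfolding m by auto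
    then show ?thesis ..
  next
    case False
    then have "only_move (digit_map q) x 1 y"
      using that t one_less_bound[OF q] unfolding m by auto
    then show ?thesis ..
  qed
qed

text \<open>The system $E_q$ has the same single moves: although $f_0$ is undefined at $qx = s$ and $f_1$ at
  $qx = 1$, each point with $1 \le qx \le s$ keeps $f_2$ and at least one of $f_0$, $f_1$.\<close>

lemma only_move_E_iff:
  assumes q: "1 < q" "q < 2" and "x \<in> I q"
  shows "(\<exists>a. only_move (E q) x a y) \<longleftrightarrow>
    q * x < 1 \<and> y = q * x \<or> 1 / (q - 1) < q * x \<and> y = q * x - 1" (is "?L \<longleftrightarrow> ?R")
proof
  have t: "0 \<le> q * x" "q * x \<le> 1 / (q - 1) + 1"
    using mem_I_iff[OF q(1)] \<open>x \<in> I q\<close> by auto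
  note m = only_move_iff E_eq_Some_iff[OF q(1)]
  show ?R if L: ?L
  proof -
    obtain a where a: "only_move (E q) x a y"
      using L ..
    have "\<not> (1 \<le> q * x \<and> q * x \<le> 1 / (q - 1))"
    proof
      assume s: "1 \<le> q * x \<and> q * x \<le> 1 / (q - 1)"
      have "a = 2"
        using a[unfolded m, rule_format, of 2 "q * x - 1"] s by auto
      moreover have "a = 0" if "q * x < 1 / (q - 1)"
        using a[unfolded m, rule_format, of 0 "q * x"] s that by auto
      moreover have "a = 1" if "\<not> q * x < 1 / (q - 1)"
        using a[unfolded m, rule_format, of 1] s that one_less_bound[OF q] by auto
      ultimately show False
        by auto
    qed
    then show ?thesis
      using a[unfolded m, rule_format, of a y] by auto
  qed
  show ?L if ?R
  proof (cases "q * x < 1")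
    case True
    then have "only_move (E q) x 0 y"
      using that t one_less_bound[OF q] unfolding m by auto
    then show ?thesis ..
  next
    case False
    then have "only_move (E q) x 2 y"
      using that t one_less_bound[OF q] unfolding m by auto
    then show ?thesis ..
  qed
qed

lemma only_move_live:
  assumes "live_on G X" "x \<in> X" "only_move G x a y"
  shows "y \<in> X"
  using assms by (auto simp: only_move_def intro: live_onD)

lemma forced_E_iff:
  assumes q: "1 < q" "q < 2" and "x \<in> I q"
  shows "forced (E q) x \<longleftrightarrow> forced (digit_map q) x"
proof
  assume "forced (E q) x"
  then show "forced (digit_map q) x"
    using forced_transfer[where h = id and G = "E q" and H = "digit_map q" and X = "I q"]
      \<open>x \<in> I q\<close> only_move_live[OF live_on_E[OF q]]
      only_move_E_iff[OF q] only_move_digit_map_iff[OF q]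
    by (metis id_apply)
next
  assume "forced (digit_map q) x"
  then show "forced (E q) x"
    using forced_transfer[where h = id and G = "digit_map q" and H = "E q" and X = "I q"]
      \<open>x \<in> I q\<close> only_move_live[OF live_on_digit_map[OF q]]
      only_move_E_iff[OF q] only_move_digit_map_iff[OF q]
    by (metis id_apply)
qed

lemma ex1_path_E_iff:
  assumes q: "1 < q" "q < 2" and "x \<in> I q"
  shows "(\<exists>!i. path (E q) x i) \<longleftrightarrow> forced (digit_map q) x"
  using ex1_path_iff_forced[OF live_on_E[OF q] \<open>x \<in> I q\<close>] forced_E_iff[OF assms] by simp

text \<open>With $s = \frac1{q-1}$, reflecting $x$ to $s - x$ turns $qx$ into $(s+1) - qx$. This swaps the
  parts of $I_q$ on the two sides of the switch region, and the digits with them.\<close>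

lemma forced_reflect:
  assumes q: "1 < q" "q < 2" and "x \<in> I q" "forced (digit_map q) x"
  shows "forced (digit_map q) (1 / (q - 1) - x)"
proof (rule forced_transfer[OF assms(4,3), where h = "\<lambda>x. 1 / (q - 1) - x"])
  fix x a y
  assume x: "x \<in> I q" "only_move (digit_map q) x a y"
  have "q * (1 / (q - 1) - x) = 1 / (q - 1) + 1 - q * x"
    using q by (simp add: field_simps)
  moreover have "1 / (q - 1) - x \<in> I q"
    using x by (auto simp: I_def)
  ultimately have "\<exists>b. only_move (digit_map q) (1 / (q - 1) - x) b (1 / (q - 1) - y)"
    using only_move_digit_map_iff[OF q x(1), of y] x(2)
    by (subst only_move_digit_map_iff[OF q]) auto
  then show "y \<in> I q \<and> (\<exists>b. only_move (digit_map q) (1 / (q - 1) - x) b (1 / (q - 1) - y))"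
    using only_move_live[OF live_on_digit_map[OF q] x] by blast
qed

lemma forced_zero:
  assumes q: "1 < q" "q < 2"
  shows "forced (digit_map q) 0"
proof -
  have "\<exists>a. only_move (digit_map q) 0 a 0"
    using q by (subst only_move_digit_map_iff[OF q]) (auto simp: I_def)
  then show ?thesis
    by (coinduction) blast
qed

section \<open>Branching into two orbits\<close>

text \<open>In the interior of the switch region all three maps are available, so a twofold branching
  happens only at an endpoint.\<close>

lemma splits_E_endpoint:
  assumes q: "1 < q" and "splits (E q) y a u b v"
  shows "q * y = 1 \<and> 1 \<in> {u, v} \<or> q * y = 1 / (q - 1) \<and> 1 / (q - 1) - 1 \<in> {u, v}"
proof -
  have S: "a \<noteq> b" "E q a y = Some u" "E q b y = Some v"
    and N: "\<And>c z. E q c y = Some z \<Longrightarrow> c = a \<or> c = b"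
    using assms(2) by (auto simp: splits_def)
  have "\<not> (1 < q * y \<and> q * y < 1 / (q - 1))"
  proof
    assume "1 < q * y \<and> q * y < 1 / (q - 1)"
    then have "E q 0 y = Some (q * y)" "E q 2 y = Some (q * y - 1)"
      "E q 1 y = Some (1 / (q - 1) - (q * y - 1) / (2 - q))"
      unfolding E_eq_Some_iff[OF q] by auto
    from this[THEN N] show False by auto
  qed
  then show ?thesis
    using S unfolding E_eq_Some_iff[OF q] by auto
qed

lemma splits_E_left_endpoint:
  assumes q: "1 < q" "q < 2"
  shows "splits (E q) (1 / q) 0 1 2 0"
proof -
  have "E q 0 (1 / q) = Some 1" "E q 2 (1 / q) = Some 0"
    using q one_less_bound[OF q] by (auto simp: E_eq_Some_iff[OF q(1)])
  moreover have "E q c (1 / q) = None" if "c \<noteq> 0" "c \<noteq> 2" for c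
    using q that E_eq_Some_iff[OF q(1), of c "1 / q"] by (cases "E q c (1 / q)") auto
  ultimately show ?thesis
    by (simp add: splits_def)
qed

theorem theorem5p5: "C2 = U"
proof -
  have "(\<exists>x\<in>I q. card (Omega q x) = 2) \<longleftrightarrow> (\<exists>!i. is_expansion q 1 i)"
    if q: "1 < q" "q < 2" for q
  proof -
    have "1 / q \<le> 1 / (q - 1)"
      using q by (intro divide_left_mono) auto
    then have I: "0 \<in> I q" "1 \<in> I q" "1 / q \<in> I q" "1 / (q - 1) - 1 \<in> I q"
      using q one_less_bound[OF q] by (auto simp: I_def)
    have U: "(\<exists>!i. is_expansion q 1 i) \<longleftrightarrow> forced (digit_map q) 1"
      using ex1_path_iff_forced[OF live_on_digit_map[OF q] I(2)] expansion_iff_path[OF q(1) I(2)]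
      by simp
    have "forced (digit_map q) 1" if x: "x \<in> I q" "card (Omega q x) = 2" for x
    proof -
      obtain y a u b v where y: "splits (E q) y a u b v"
        "\<exists>!i. path (E q) u i" "\<exists>!j. path (E q) v j"
        using card_paths_2_imp_split[OF live_on_E[OF q] x(1)] x(2)
        unfolding Omega_eq_paths[OF q x(1)] by blast
      then have "1 \<in> {z. \<exists>!i. path (E q) z i} \<or> 1 / (q - 1) - 1 \<in> {z. \<exists>!i. path (E q) z i}"
        using splits_E_endpoint[OF q(1) y(1)] by blast
      then have "forced (digit_map q) 1 \<or> forced (digit_map q) (1 / (q - 1) - 1)"
        using ex1_path_E_iff[OF q] I by simp
      then show ?thesis
        using forced_reflect[OF q I(4)] by auto
    qed
    moreover have "card (Omega q (1 / q)) = 2" if "forced (digit_map q) 1"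
      using card_paths_split[OF splits_E_left_endpoint[OF q]] that forced_zero[OF q]
        ex1_path_E_iff[OF q] I Omega_eq_paths[OF q I(3)] by simp
    ultimately show ?thesis
      using U I(3) by blast
  qed
  then show ?thesis
    by (simp add: C2_def U_def cong: conj_cong)
qed

end
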